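(* Let $m\geq 0$ be an integer. If $\mathscr{B}\subseteq\mathbb{N}$ is a divisor closed set of density $0$, then $\mathscr{B}\cdot\mathbb{P}_m$ also has density $0$.
   Context: $\mathbb{N}$ denotes the positive integers. A set $\mathscr{A}\subseteq\mathbb{N}$ is divisor closed if whenever $n\in\mathscr{A}$ and $d\mid n$ one has $d\in\mathscr{A}$. For $\mathscr{A},\mathscr{B}\subseteq\mathbb{N}$, $\mathscr{A}\cdot\mathscr{B}=\{ab : a\in\mathscr{A},\, b\in\mathscr{B}\}$. For an integer $m\geq 0$, $\mathbb{P}_m=\{n\in\mathbb{N}:\omega(n)\leq m\}$, where $\omega(n)=\sum_{p\mid n}1$ is the number of distinct prime divisors of $n$. Density means natural density. *)

theory Defs
  imports Complex_Main "HOL-Library.Set_Algebras" "HOL-Computational_Algebra.Primes"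
begin

text \<open>
  Sets of positive integers are rendered as sets \<open>A :: nat set\<close> with \<open>A \<subseteq> {0<..}\<close>.
  The product set of \<open>A\<close> and \<open>B\<close> is \<open>A * B\<close> in the sense of \<^theory>\<open>HOL-Library.Set_Algebras\<close>.
\<close>

definition divisor_closed :: "nat set \<Rightarrow> bool" where
  "divisor_closed A \<longleftrightarrow> (\<forall>n\<in>A. \<forall>d. d dvd n \<longrightarrow> d \<in> A)"

definition omega :: "nat \<Rightarrow> nat" where
  "omega n = card (prime_factors n)"

definition omega_at_most :: "nat \<Rightarrow> nat set" where
  "omega_at_most m = {n. 0 < n \<and> omega n \<le> m}"

definition has_natural_density :: "nat set \<Rightarrow> real \<Rightarrow> bool" where
  "has_natural_density A \<delta> \<longleftrightarrow> (\<lambda>N. real (card (A \<inter> {1..N})) / real N) \<longlonglongrightarrow> \<delta>"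

end

theory Submission
  imports Defs "HOL-Analysis.Harmonic_Numbers"
begin

text \<open>
  By induction on \<open>m\<close> it suffices to multiply a divisor closed null set \<open>B\<close> by the set of prime powers.
  Given \<open>y\<close>, let \<open>B\<^sub>y\<close> be the set of all \<open>n\<close> whose \<open>y\<close>-smooth part lies in \<open>B\<close>. If \<open>b \<in> B\<close> and
  \<open>p > y\<close>, then \<open>b p\<^sup>k\<close> has the same \<open>y\<close>-smooth part as \<open>b\<close>, which divides \<open>b\<close>; so \<open>b p\<^sup>k \<in> B\<^sub>y\<close>.
  The finitely many \<open>p \<le> y\<close> contribute a null set, because \<open>\<Sum>\<^sub>k p\<^sup>-\<^sup>k\<close> converges. It remains to make
  the density of \<open>B\<^sub>y\<close> small. Outside a set of upper density \<open>4 / K\<close>, the \<open>y\<close>-smooth part is at most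
  \<open>y\<^sup>K\<close>, since its logarithm is \<open>O(ln y)\<close> on average. The remaining part of \<open>B\<^sub>y\<close> has upper density at most
  \<open>1 / ln y\<close> times the sum of \<open>1 / b\<close> over \<open>b \<in> B\<close>, \<open>b \<le> y\<^sup>K\<close>, and that sum is \<open>o(K ln y)\<close> as \<open>B\<close> is null.
\<close>

section \<open>The \<open>y\<close>-smooth part of an integer\<close>

text \<open>For \<open>n > 0\<close> this is the largest divisor of \<open>n\<close> without prime
  factors above \<open>y\<close>. At \<open>n = 0\<close> all multiplicities are 0, so the value is
  1, not 0.\<close>

definition smooth_part :: "nat \<Rightarrow> nat \<Rightarrow> nat" where
  "smooth_part y n = (\<Prod>p | prime p \<and> p \<le> y. p ^ multiplicity p n)"

lemma finite_primes_le: "finite {p :: nat. prime p \<and> p \<le> y}"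
  by (rule finite_subset[of _ "{..y}"]) auto

lemma smooth_part_pos: "0 < smooth_part y n"
  unfolding smooth_part_def by (rule prod_pos) (auto simp: prime_gt_0_nat)

lemma smooth_part_mult:
  "a > 0 \<Longrightarrow> b > 0 \<Longrightarrow> smooth_part y (a * b) = smooth_part y a * smooth_part y b"
  unfolding smooth_part_def prod.distrib[symmetric]
  by (rule prod.cong) (auto simp: prime_elem_multiplicity_mult_distrib power_add)

lemma smooth_part_self:
  assumes "0 < n" "n \<le> y"
  shows "smooth_part y n = n"
proof -
  have "n = (\<Prod>p\<in>prime_factors n. p ^ multiplicity p n)"
    using assms by (simp add: prod_prime_factors)
  also have "\<dots> = smooth_part y n"
    unfolding smooth_part_def
  proof (intro prod.mono_neutral_left finite_primes_le)
    show "prime_factors n \<subseteq> {p. prime p \<and> p \<le> y}"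
      using assms by (auto simp: prime_factors_dvd dest: dvd_imp_le)
  qed (use assms in \<open>auto simp: prime_factors_multiplicity\<close>)
  finally show ?thesis by simp
qed

lemma smooth_part_eq_1:
  assumes "\<And>p. prime p \<Longrightarrow> p \<le> y \<Longrightarrow> \<not> p dvd n"
  shows "smooth_part y n = 1"
  unfolding smooth_part_def using assms
  by (intro prod.neutral) (auto simp: not_dvd_imp_multiplicity_0)

text \<open>The primes up to \<open>y\<close> are exactly the prime divisors of \<open>y!\<close>,
  so a single modulus expresses the absence of small primes.\<close>

lemma smooth_part_coprime_fact:
  assumes "coprime n (fact y)"
  shows "smooth_part y n = 1"
proof (rule smooth_part_eq_1)
  fix p :: nat assume p: "prime p" "p \<le> y"
  then have "p dvd fact y" by (simp add: prime_dvd_fact_iff)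
  with assms p show "\<not> p dvd n"
    by (meson coprime_common_divisor not_prime_unit)
qed

lemma multiplicity_smooth_part:
  assumes "prime p" "p \<le> y"
  shows "multiplicity p (smooth_part y n) = multiplicity p n"
  unfolding smooth_part_def
  using assms by (subst multiplicity_prod_prime_powers) (auto simp: finite_primes_le)

text \<open>Raising the bound from \<open>y\<close> to \<open>max n y\<close> only adds factors, and
  it turns the smooth part into \<open>n\<close> itself.\<close>

lemma smooth_part_dvd:
  assumes "n > 0"
  shows "smooth_part y n dvd n"
proof -
  have "smooth_part y n dvd (\<Prod>p | prime p \<and> p \<le> max n y. p ^ multiplicity p n)"
    unfolding smooth_part_def
    by (intro prod_dvd_prod_subset finite_primes_le) auto
  also have "\<dots> = smooth_part (max n y) n" by (simp add: smooth_part_def)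
  also have "\<dots> = n" using assms by (intro smooth_part_self) auto
  finally show ?thesis .
qed

text \<open>A prime up to \<open>y\<close> has the same multiplicity in \<open>n\<close> as in its
  smooth part, so none is left for the quotient.\<close>

lemma coprime_div_smooth_part:
  assumes "n > 0"
  shows "coprime (n div smooth_part y n) (fact y)"
proof (rule ccontr)
  assume "\<not> ?thesis"
  then obtain p where p: "prime p" "p dvd n div smooth_part y n" "p dvd fact y"
    by (metis coprime_iff_gcd_eq_1 prime_factor_nat gcd_greatest_iff)
  then have py: "p \<le> y" by (simp add: prime_dvd_fact_iff)
  let ?r = "n div smooth_part y n"
  have n: "n = smooth_part y n * ?r" using smooth_part_dvd[OF assms] by simp
  then have "?r \<noteq> 0" using assms by (metis mult_0_right less_numeral_extra(3))
  have "multiplicity p n = multiplicity p (smooth_part y n) + multiplicity p ?r"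
    using p(1) \<open>?r \<noteq> 0\<close> smooth_part_pos[of y n]
    by (subst n) (auto simp: prime_elem_multiplicity_mult_distrib)
  then have "multiplicity p ?r = 0" by (simp add: multiplicity_smooth_part p(1) py)
  moreover have "multiplicity p ?r \<noteq> 0"
    using p \<open>?r \<noteq> 0\<close> by (simp add: prime_multiplicity_gt_zero_iff prime_imp_prime_elem)
  ultimately show False by simp
qed

section \<open>The logarithm of the smooth part on average\<close>

lemma ln_smooth_part:
  "ln (real (smooth_part y n)) = (\<Sum>p | prime p \<and> p \<le> y. real (multiplicity p n) * ln (real p))"
  unfolding smooth_part_def of_nat_prod
  by (subst ln_prod) (auto simp: finite_primes_le prime_gt_0_nat ln_realpow)

text \<open>Only multiples \<open>p * m\<close> contribute, and removing one factor \<open>p\<close>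
  lowers the multiplicity by 1. Iterated, this is Legendre's formula for \<open>x!\<close>.\<close>

lemma sum_multiplicity_rec:
  fixes p x :: nat
  assumes "prime p"
  shows "(\<Sum>n=1..x. multiplicity p n) = x div p + (\<Sum>n=1..x div p. multiplicity p n)"
proof -
  have p: "p > 0" using assms by (simp add: prime_gt_0_nat)
  have "(\<Sum>n=1..x. multiplicity p n) = (\<Sum>n\<in>(\<lambda>m. p * m) ` {1..x div p}. multiplicity p n)"
  proof (rule sum.mono_neutral_right)
    show "(\<lambda>m. p * m) ` {1..x div p} \<subseteq> {1..x}"
      using p by (auto simp: less_eq_div_iff_mult_less_eq mult.commute)
    show "\<forall>i\<in>{1..x} - (\<lambda>m. p * m) ` {1..x div p}. multiplicity p i = 0"
    proof
      fix i assume i: "i \<in> {1..x} - (\<lambda>m. p * m) ` {1..x div p}"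
      have "\<not> p dvd i"
      proof
        assume "p dvd i"
        then obtain m where "i = p * m" by blast
        with i p have "m \<in> {1..x div p}"
          by (auto simp: less_eq_div_iff_mult_less_eq mult.commute Suc_le_eq)
        with i \<open>i = p * m\<close> show False by blast
      qed
      then show "multiplicity p i = 0" by (rule not_dvd_imp_multiplicity_0)
    qed
  qed auto
  also have "\<dots> = (\<Sum>m=1..x div p. multiplicity p (p * m))"
    using p by (subst sum.reindex) (auto simp: inj_on_def)
  also have "\<dots> = (\<Sum>m=1..x div p. 1 + multiplicity p m)"
    using assms by (intro sum.cong) (auto simp: prime_elem_multiplicity_mult_distrib)
  also have "\<dots> = x div p + (\<Sum>n=1..x div p. multiplicity p n)"
    by (simp only: sum.distrib) simp
  finally show ?thesis .
qed

text \<open>The geometric series x/p + x/p^2 + ... = x/(p - 1), in integers. With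
  \<open>q = x div p\<close> the recursion yields at most (p - 1) q + q = p q \<le> x.\<close>

lemma sum_multiplicity_le:
  fixes p x :: nat
  assumes "prime p"
  shows "(p - 1) * (\<Sum>n=1..x. multiplicity p n) \<le> x"
proof (induction x rule: less_induct)
  case (less x)
  show ?case
  proof (cases "x = 0")
    case False
    have p: "p > 1" using assms by (rule prime_gt_1_nat)
    have "(p - 1) * (\<Sum>n=1..x div p. multiplicity p n) \<le> x div p"
      using less[of "x div p"] False p by simp
    then have "(p - 1) * (\<Sum>n=1..x. multiplicity p n) \<le> (p - 1) * (x div p) + x div p"
      by (subst sum_multiplicity_rec[OF assms]) (simp add: add_mult_distrib2)
    also have "\<dots> = p * (x div p)" using p by (cases p) auto
    also have "\<dots> \<le> x" by simp
    finally show ?thesis .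
  qed simp
qed

lemma sum_ln_smooth_part:
  "(\<Sum>n=1..x. ln (real (smooth_part y n)))
     = (\<Sum>p | prime p \<and> p \<le> y. ln (real p) * real (\<Sum>n=1..x. multiplicity p n))"
  unfolding ln_smooth_part
  by (subst sum.swap) (simp add: sum_distrib_left mult.commute)

text \<open>
  Compares \<open>ln (y!)\<close> with its prime factorization; the crude bound \<open>y div p \<ge> y / (2 p)\<close> for \<open>p \<le> y\<close>
  avoids Chebyshev's estimate.
\<close>
lemma sum_ln_prime_over_prime_le:
  assumes "y > 0"
  shows "(\<Sum>p | prime p \<and> p \<le> y. ln (real p) / real p) \<le> 2 * ln (real y)"
proof -
  have "real y * (\<Sum>p | prime p \<and> p \<le> y. ln (real p) / real p)
      = (\<Sum>p | prime p \<and> p \<le> y. ln (real p) * (real y / real p))"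
    by (simp add: sum_distrib_left mult.commute)
  also have "\<dots> \<le> (\<Sum>p | prime p \<and> p \<le> y. 2 * (ln (real p) * real (\<Sum>n=1..y. multiplicity p n)))"
  proof (rule sum_mono)
    fix p assume "p \<in> {p. prime p \<and> p \<le> y}"
    then have p: "prime p" "p \<le> y" "p > 0" "p \<ge> 1" using prime_gt_0_nat[of p] by auto
    have d: "y div p \<ge> 1" using p by (simp add: less_eq_div_iff_mult_less_eq)
    have "y = p * (y div p) + y mod p" by simp
    also have "\<dots> \<le> p * (y div p) + p * 1" using p by (intro add_mono) (auto intro: less_imp_le)
    also have "\<dots> \<le> p * (y div p) + p * (y div p)" using d by (intro add_mono mult_le_mono) auto
    finally have "y \<le> p * (2 * (y div p))" by simp
    then have "real y \<le> real (p * (2 * (y div p)))" by (rule of_nat_mono)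
    then have "real y / real p \<le> 2 * real (y div p)" using p by (simp add: field_simps)
    \<comment> \<open>Only the first term of Legendre's formula is kept.\<close>
    also have "y div p \<le> (\<Sum>n=1..y. multiplicity p n)"
      by (subst sum_multiplicity_rec[OF p(1)]) simp
    finally have *: "real y / real p \<le> 2 * real (\<Sum>n=1..y. multiplicity p n)" by simp
    have "ln (real p) * (real y / real p) \<le> ln (real p) * (2 * real (\<Sum>n=1..y. multiplicity p n))"
      using p by (intro mult_left_mono *) auto
    then show "ln (real p) * (real y / real p) \<le> 2 * (ln (real p) * real (\<Sum>n=1..y. multiplicity p n))"
      by (simp only: mult_ac)
  qed
  also have "\<dots> = 2 * (\<Sum>n=1..y. ln (real (smooth_part y n)))"
    by (simp only: sum_ln_smooth_part sum_distrib_left)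
  \<comment> \<open>Each \<open>n \<le> y\<close> is its own smooth part, so the sum is ln
    (y!).\<close>
  also have "(\<Sum>n=1..y. ln (real (smooth_part y n))) = (\<Sum>n=1..y. ln (real n))"
    by (intro sum.cong) (auto simp: smooth_part_self)
  also have "\<dots> \<le> (\<Sum>n=1..y. ln (real y))" by (intro sum_mono) auto
  also have "\<dots> = real y * ln (real y)" by simp
  finally have "real y * (\<Sum>p | prime p \<and> p \<le> y. ln (real p) / real p) \<le> real y * (2 * ln (real y))"
    by simp
  then show ?thesis using assms by simp
qed

text \<open>Each prime contributes at most x ln p / (p - 1) \<le> 2 x ln p / p; the bound 2 ln y for
  the sum of ln p / p supplies the other factor 2.\<close>

lemma sum_ln_smooth_part_le:
  assumes "y > 0"
  shows "(\<Sum>n=1..x. ln (real (smooth_part y n))) \<le> 4 * real x * ln (real y)"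
proof -
  have "(\<Sum>n=1..x. ln (real (smooth_part y n)))
     \<le> (\<Sum>p | prime p \<and> p \<le> y. 2 * real x * (ln (real p) / real p))"
    unfolding sum_ln_smooth_part
  proof (rule sum_mono)
    fix p assume "p \<in> {p. prime p \<and> p \<le> y}"
    then have p: "prime p" "p \<ge> 2" using prime_ge_2_nat[of p] by auto
    define S where "S = (\<Sum>n=1..x. multiplicity p n)"
    have "p * S \<le> 2 * (p - 1) * S" using p by (intro mult_le_mono) auto
    also have "\<dots> \<le> 2 * x" using sum_multiplicity_le[OF p(1), of x] by (simp add: S_def)
    finally have "real (p * S) \<le> real (2 * x)" by (rule of_nat_mono)
    then have "real S \<le> 2 * real x / real p" using p by (simp add: field_simps)
    then have "ln (real p) * real S \<le> ln (real p) * (2 * real x / real p)"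
      using p by (intro mult_left_mono) auto
    then show "ln (real p) * real (\<Sum>n=1..x. multiplicity p n) \<le> 2 * real x * (ln (real p) / real p)"
      unfolding S_def by (simp add: mult_ac)
  qed
  also have "\<dots> = 2 * real x * (\<Sum>p | prime p \<and> p \<le> y. ln (real p) / real p)"
    by (simp add: sum_distrib_left)
  also have "\<dots> \<le> 2 * real x * (2 * ln (real y))"
    by (intro mult_left_mono sum_ln_prime_over_prime_le assms) auto
  finally show ?thesis by simp
qed

text \<open>Markov's inequality for the logarithm of the smooth part: its mean is at most 4 ln y and
  the threshold is K ln y.\<close>

lemma card_large_smooth_part:
  assumes "y \<ge> 2" "K > 0"
  shows "real (card {n\<in>{1..x}. smooth_part y n > y ^ K}) \<le> 4 * real x / real K"
proof -
  let ?E = "{n\<in>{1..x}. smooth_part y n > y ^ K}"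
  have ly: "ln (real y) > 0" using assms by simp
  have "real (card ?E) * (real K * ln (real y)) = (\<Sum>n\<in>?E. ln (real (y ^ K)))"
    using assms by (simp add: ln_realpow)
  also have "\<dots> \<le> (\<Sum>n\<in>?E. ln (real (smooth_part y n)))"
  proof (rule sum_mono)
    fix n assume "n \<in> ?E"
    then have "real (y ^ K) \<le> real (smooth_part y n)" by (intro of_nat_mono) auto
    then show "ln (real (y ^ K)) \<le> ln (real (smooth_part y n))"
      using assms by (intro ln_mono) auto
  qed
  also have "\<dots> \<le> (\<Sum>n=1..x. ln (real (smooth_part y n)))"
    using smooth_part_pos by (intro sum_mono2) (auto simp: Suc_le_eq)
  also have "\<dots> \<le> 4 * real x * ln (real y)" using assms by (intro sum_ln_smooth_part_le) auto
  finally have "real (card ?E) * real K \<le> 4 * real x" using ly by (simp add: mult.assoc[symmetric])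
  then show ?thesis using assms by (simp add: field_simps)
qed

section \<open>Counting integers coprime to \<open>y!\<close>\<close>

text \<open>Coprimality to \<open>Q\<close> has period \<open>Q\<close>, so every block of length
  \<open>Q\<close> contributes equally.\<close>

lemma card_coprime_atMost_mult:
  fixes Q t :: nat
  shows "card {m\<in>{1..Q * t}. coprime m Q} = t * card {m\<in>{1..Q}. coprime m Q}"
proof (induction t)
  case (Suc t)
  let ?f = "\<lambda>m. m + Q * t"
  have coprime_iff: "coprime (?f k) Q \<longleftrightarrow> coprime k Q" for k
    by (metis coprime_iff_gcd_eq_1 gcd_add_mult add.commute gcd.commute mult.commute)
  have "{m\<in>{1..Q * Suc t}. coprime m Q}
      = {m\<in>{1..Q * t}. coprime m Q} \<union> ?f ` {m\<in>{1..Q}. coprime m Q}" (is "_ = ?A \<union> ?B")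
  proof (intro equalityI subsetI)
    fix m assume m: "m \<in> {m\<in>{1..Q * Suc t}. coprime m Q}"
    show "m \<in> ?A \<union> ?B"
    proof (cases "m \<le> Q * t")
      case False
      then have eq: "m = ?f (m - Q * t)" by simp
      have "coprime (m - Q * t) Q"
        using m eq coprime_iff[of "m - Q * t"] by simp
      then have "m - Q * t \<in> {m\<in>{1..Q}. coprime m Q}" using m False by auto
      with eq show ?thesis by blast
    qed (use m in auto)
  next
    fix m assume "m \<in> ?A \<union> ?B"
    then show "m \<in> {m\<in>{1..Q * Suc t}. coprime m Q}"
      by (auto simp: coprime_iff)
  qed
  moreover have "?A \<inter> ?B = {}" by auto
  moreover have "card ?B = card {m\<in>{1..Q}. coprime m Q}" by (intro card_image) (auto simp: inj_on_def)
  ultimately show ?case using Suc by (simp add: card_Un_disjoint)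
qed simp

text \<open>Rounds \<open>x\<close> up to whole periods, at the price of one extra block.\<close>

lemma card_coprime_atMost_le:
  fixes Q x :: nat
  assumes "Q > 0"
  shows "card {m\<in>{1..x}. coprime m Q} \<le> (x div Q + 1) * card {m\<in>{1..Q}. coprime m Q}"
proof -
  have "x = Q * (x div Q) + x mod Q" by simp
  also have "\<dots> \<le> Q * (x div Q) + Q" using assms by (intro add_mono) (auto intro: less_imp_le)
  finally have "x \<le> Q * (x div Q + 1)" by simp
  then have "card {m\<in>{1..x}. coprime m Q} \<le> card {m\<in>{1..Q * (x div Q + 1)}. coprime m Q}"
    by (intro card_mono) auto
  then show ?thesis by (simp only: card_coprime_atMost_mult)
qed

text \<open>
  The products of \<open>j \<le> y\<close> with integers coprime to \<open>y!\<close> are pairwise distinct, as \<open>j\<close> is recovered as the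
  \<open>y\<close>-smooth part. Counting those up to \<open>(y!)\<^sup>2\<close> gives the bound without Mertens' product formula.
\<close>
lemma card_coprime_fact_le:
  "real (card {m\<in>{1..fact y :: nat}. coprime m (fact y)}) * harm y \<le> fact y"
proof -
  define Q :: nat where "Q = fact y"
  define \<phi> where "\<phi> = card {m\<in>{1..Q}. coprime m Q}"
  have Q: "Q > 0" by (simp add: Q_def)
  \<comment> \<open>The range consists of \<open>Q div j\<close> full periods, so the count is
    exact, while all products \<open>j * m\<close> stay below \<open>Q * Q\<close>.\<close>
  let ?R = "\<lambda>j. {m\<in>{1..Q * (Q div j)}. coprime m Q}"
  have "(\<Sum>j=1..y. Q div j * \<phi>) = (\<Sum>j=1..y. card (?R j))"
    by (simp only: card_coprime_atMost_mult \<phi>_def)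
  also have "\<dots> = card (SIGMA j:{1..y}. ?R j)" by (subst card_SigmaI) auto
  also have "\<dots> \<le> card {1..Q * Q}"
  proof (rule card_inj_on_le[where f = "\<lambda>(j, m). j * m"])
    have sm: "smooth_part y (j * m) = j" if "j \<in> {1..y}" "m \<in> ?R j" for j m
      using that by (subst smooth_part_mult) (auto simp: smooth_part_self smooth_part_coprime_fact Q_def)
    show "inj_on (\<lambda>(j, m). j * m) (SIGMA j:{1..y}. ?R j)"
    proof (rule inj_onI, clarsimp)
      fix j m j' m' assume a: "Suc 0 \<le> j" "j \<le> y" "Suc 0 \<le> m" "m \<le> Q * (Q div j)" "coprime m Q"
        "Suc 0 \<le> j'" "j' \<le> y" "Suc 0 \<le> m'" "m' \<le> Q * (Q div j')" "coprime m' Q" "j * m = j' * m'"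
      have "j = smooth_part y (j * m)" using a by (subst sm) auto
      also have "\<dots> = smooth_part y (j' * m')" using a by simp
      also have "\<dots> = j'" using a by (subst sm) auto
      finally show "j = j' \<and> m = m'" using a by auto
    qed
    show "(\<lambda>(j, m). j * m) ` (SIGMA j:{1..y}. ?R j) \<subseteq> {1..Q * Q}"
    proof (rule image_subsetI, clarify)
      fix j m assume "j \<in> {1..y}" "m \<in> {1..Q * (Q div j)}"
      then have a: "0 < j" "0 < m" "m \<le> Q * (Q div j)" by auto
      have "j * m \<le> j * (Q * (Q div j))" using a by simp
      also have "\<dots> = Q * (j * (Q div j))" by simp
      also have "\<dots> \<le> Q * Q" by (intro mult_le_mono) auto
      finally show "j * m \<in> {1..Q * Q}" using a by (simp add: Suc_le_eq)
    qed
  qed auto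
  finally have le: "(\<Sum>j=1..y. Q div j * \<phi>) \<le> Q * Q" by simp
  have "real Q * (real \<phi> * harm y) = (\<Sum>j=1..y. real (Q div j * \<phi>))"
  proof -
    have "real (Q div j * \<phi>) = real Q * (real \<phi> * inverse (real j))" if "j \<in> {1..y}" for j
    proof -
      \<comment> \<open>As \<open>j \<le> y\<close> divides \<open>y!\<close>, the quotients
        \<open>Q div j\<close> are exact and add up to \<open>Q * harm y\<close>.\<close>
      have "j dvd Q" using that by (auto simp: Q_def dvd_fact)
      then show ?thesis using that by (simp add: real_of_nat_div field_simps)
    qed
    then show ?thesis unfolding harm_def sum_distrib_left by (intro sum.cong) (auto simp del: of_nat_mult)
  qed
  also have "\<dots> \<le> real Q * real Q" using of_nat_mono[OF le, where ?'a = real] by simp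
  finally have "real \<phi> * harm y \<le> real Q" using Q by simp
  then show ?thesis by (simp add: \<phi>_def Q_def)
qed

section \<open>Null sets and their reciprocal sums\<close>

text \<open>Clears the denominator, so that counting bounds can be added directly.\<close>

lemma has_natural_density_0_iff:
  "has_natural_density A 0 \<longleftrightarrow>
     (\<forall>\<epsilon>>0. \<forall>\<^sub>F x in sequentially. real (card (A \<inter> {1..x})) \<le> \<epsilon> * real x)"
proof
  assume A: "has_natural_density A 0"
  show "\<forall>\<epsilon>>0. \<forall>\<^sub>F x in sequentially. real (card (A \<inter> {1..x})) \<le> \<epsilon> * real x"
  proof (intro allI impI)
    fix \<epsilon> :: real assume "\<epsilon> > 0"
    with A have "\<forall>\<^sub>F x in sequentially. real (card (A \<inter> {1..x})) / real x < \<epsilon>"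
      unfolding has_natural_density_def by (rule order_tendstoD)
    with eventually_gt_at_top[of 0]
    show "\<forall>\<^sub>F x in sequentially. real (card (A \<inter> {1..x})) \<le> \<epsilon> * real x"
      by eventually_elim (simp add: field_simps)
  qed
next
  assume A: "\<forall>\<epsilon>>0. \<forall>\<^sub>F x in sequentially. real (card (A \<inter> {1..x})) \<le> \<epsilon> * real x"
  show "has_natural_density A 0"
    unfolding has_natural_density_def tendsto_iff
  proof (intro allI impI)
    fix \<epsilon> :: real assume "\<epsilon> > 0"
    \<comment> \<open>Half of \<epsilon> turns the weak inequality into the strict one of the
      limit.\<close>
    then have "\<forall>\<^sub>F x in sequentially. real (card (A \<inter> {1..x})) \<le> \<epsilon> / 2 * real x"
      using A half_gt_zero by blast
    with eventually_gt_at_top[of 0]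
    show "\<forall>\<^sub>F x in sequentially. dist (real (card (A \<inter> {1..x})) / real x) 0 < \<epsilon>"
    proof eventually_elim
      case (elim x)
      then have "real (card (A \<inter> {1..x})) / real x \<le> \<epsilon> / 2"
        by (simp add: divide_le_eq)
      also have "\<dots> < \<epsilon>" using \<open>\<epsilon> > 0\<close> by simp
      finally show ?case by simp
    qed
  qed
qed

text \<open>Partial summation against the counting function \<open>c\<close>, with 1/t - 1/(t + 1) =
  1/(t (t + 1)).\<close>

lemma sum_inverse_abel:
  fixes B :: "nat set"
  defines "c \<equiv> \<lambda>t. real (card (B \<inter> {1..t}))"
  shows "(\<Sum>b\<in>B \<inter> {1..z}. 1 / real b)
     = c z / (real z + 1) + (\<Sum>t=1..z. c t / (real t * (real t + 1)))"
proof (induction z)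
  case 0
  show ?case by (simp add: c_def)
next
  case (Suc z)
  have B: "B \<inter> {1..Suc z} = (if Suc z \<in> B then insert (Suc z) (B \<inter> {1..z}) else B \<inter> {1..z})"
    by (auto simp: le_Suc_eq)
  have c: "c (Suc z) = c z + of_bool (Suc z \<in> B)"
    unfolding c_def B by auto
  have "(\<Sum>b\<in>B \<inter> {1..Suc z}. 1 / real b)
      = (\<Sum>b\<in>B \<inter> {1..z}. 1 / real b) + of_bool (Suc z \<in> B) / (real z + 1)"
    unfolding B by (auto simp: add_ac)
  also have "\<dots> = (\<Sum>t=1..z. c t / (real t * (real t + 1))) + c (Suc z) / (real z + 1)"
    unfolding Suc c by (simp add: add_divide_distrib)
  \<comment> \<open>Splits off the new summand at \<open>t = z + 1\<close>; the rest is the new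
    boundary term.\<close>
  also have "c (Suc z) / (real z + 1)
      = c (Suc z) / ((real z + 1) * (real z + 2)) + c (Suc z) / (real z + 2)"
    by (simp add: divide_simps) (simp add: algebra_simps)
  finally show ?case by (simp add: add_ac)
qed

text \<open>In the Abel sum, \<open>c t \<le> \<epsilon> * t\<close> from some \<open>T\<close> on
  gives terms at most \<epsilon>/t. Earlier terms and the boundary term are each at most 1, so
  \<open>C = T + 1\<close> works for all \<open>z\<close>.\<close>

lemma sum_inverse_null_set_le:
  assumes "has_natural_density B 0" and "\<epsilon> > 0"
  obtains C where "\<And>z. (\<Sum>b\<in>B \<inter> {1..z}. 1 / real b) \<le> \<epsilon> * harm z + C"
proof -
  define c where "c = (\<lambda>t. real (card (B \<inter> {1..t})))"
  obtain T where T: "\<And>t. t \<ge> T \<Longrightarrow> c t \<le> \<epsilon> * real t"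
    using assms unfolding has_natural_density_0_iff eventually_sequentially c_def by blast
  have c_le: "c t \<le> real t" for t
  proof -
    have "card (B \<inter> {1..t}) \<le> card {1..t}" by (intro card_mono) auto
    then show ?thesis by (simp add: c_def)
  qed
  have c_ge: "c t \<ge> 0" for t by (simp add: c_def)
  have "(\<Sum>b\<in>B \<inter> {1..z}. 1 / real b) \<le> \<epsilon> * harm z + (real T + 1)" for z
  proof -
    have "c z / (real z + 1) \<le> 1" using c_le[of z] by simp
    moreover have "(\<Sum>t=1..z. c t / (real t * (real t + 1)))
        \<le> (\<Sum>t=1..z. of_bool (t < T) + \<epsilon> * inverse (real t))"
    proof (rule sum_mono)
      fix t assume t: "t \<in> {1..z}"
      show "c t / (real t * (real t + 1)) \<le> of_bool (t < T) + \<epsilon> * inverse (real t)"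
      proof (cases "t < T")
        case True
        have "c t \<le> real t * (real t + 1)"
          using c_le[of t] t by (intro order_trans[OF c_le]) (simp add: algebra_simps)
        then have "c t / (real t * (real t + 1)) \<le> 1" using t by simp
        moreover have "\<epsilon> * inverse (real t) \<ge> 0" using assms by simp
        ultimately show ?thesis using True by simp
      next
        case False
        have "c t / (real t * (real t + 1)) \<le> c t / (real t * real t)"
          using t c_ge by (intro divide_left_mono mult_left_mono) auto
        also have "\<dots> \<le> \<epsilon> * real t / (real t * real t)"
          using False T by (intro divide_right_mono) auto
        also have "\<dots> = \<epsilon> * inverse (real t)" using t by (simp add: field_simps)
        finally show ?thesis using False by simp
      qed
    qed
    moreover have "(\<Sum>t=1..z. of_bool (t < T)) \<le> real T"
    proof -
      have "(\<Sum>t=1..z. of_bool (t < T)) = real (card ({1..z} \<inter> {t. t < T}))"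
        by (simp add: sum.inter_restrict[symmetric] of_bool_def sum.If_cases)
      also have "card ({1..z} \<inter> {t. t < T}) \<le> card {..<T}" by (intro card_mono) auto
      finally show ?thesis by simp
    qed
    ultimately show ?thesis
      unfolding sum_inverse_abel c_def sum.distrib sum_distrib_left[symmetric] harm_def
      by linarith
  qed
  then show ?thesis by (rule that)
qed

section \<open>Integers whose smooth part lies in a null set\<close>

text \<open>Dividing by \<open>b\<close> injects these \<open>n\<close> into the integers up to
  \<open>x div b\<close> coprime to \<open>y!\<close>.\<close>

lemma card_smooth_part_eq_le:
  assumes "b > 0"
  shows "card {n\<in>{1..x}. smooth_part y n = b}
       \<le> (x div b div fact y + 1) * card {m\<in>{1..fact y :: nat}. coprime m (fact y)}"
proof -
  have "card {n\<in>{1..x}. smooth_part y n = b} \<le> card {m\<in>{1..x div b}. coprime m (fact y)}"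
  proof (rule card_inj_on_le[where f = "\<lambda>n. n div b"])
    have dvd: "b dvd n" if "n \<in> {n\<in>{1..x}. smooth_part y n = b}" for n
      using that smooth_part_dvd[of n y] by auto
    show "inj_on (\<lambda>n. n div b) {n\<in>{1..x}. smooth_part y n = b}"
      by (rule inj_onI) (metis dvd dvd_mult_div_cancel)
    show "(\<lambda>n. n div b) ` {n\<in>{1..x}. smooth_part y n = b} \<subseteq> {m\<in>{1..x div b}. coprime m (fact y)}"
    proof (rule image_subsetI)
      fix n assume n: "n \<in> {n\<in>{1..x}. smooth_part y n = b}"
      then have "n div b > 0" using dvd[OF n] assms by (auto simp: div_greater_zero_iff dvd_imp_le)
      then show "n div b \<in> {m\<in>{1..x div b}. coprime m (fact y)}"
        using n coprime_div_smooth_part[of n y] by (auto simp: div_le_mono)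
    qed
  qed auto
  also have "\<dots> \<le> (x div b div fact y + 1) * card {m\<in>{1..fact y :: nat}. coprime m (fact y)}"
    by (rule card_coprime_atMost_le) (rule fact_gt_zero)
  finally show ?thesis .
qed

text \<open>Sums the previous bound over \<open>b\<close>. The proportion \<phi>/Q is at most
  \<open>1 / harm y\<close>; the extra block for each of at most \<open>z\<close> values
  \<open>b\<close> costs at most \<open>y!\<close>, an error independent of
  \<open>x\<close>.\<close>

lemma card_smooth_part_in_le:
  assumes "y > 0"
  shows "real (card {n\<in>{1..x}. smooth_part y n \<in> B \<inter> {1..z}})
     \<le> real x * (\<Sum>b\<in>B \<inter> {1..z}. 1 / real b) / harm y + real z * fact y"
proof -
  define Q :: nat where "Q = fact y"
  define \<phi> where "\<phi> = card {m\<in>{1..Q}. coprime m Q}"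
  define S where "S = (\<Sum>b\<in>B \<inter> {1..z}. 1 / real b)"
  have Q: "Q > 0" by (simp add: Q_def)
  have H: "harm y > (0 :: real)" using assms by (rule harm_pos)
  have "\<phi> \<le> card {1..Q}" unfolding \<phi>_def by (intro card_mono) auto
  then have \<phi>: "\<phi> \<le> Q" by simp
  have S: "S \<ge> 0" unfolding S_def by (intro sum_nonneg) auto
  have "{n\<in>{1..x}. smooth_part y n \<in> B \<inter> {1..z}}
      = (\<Union>b\<in>B \<inter> {1..z}. {n\<in>{1..x}. smooth_part y n = b})" by auto
  then have "card {n\<in>{1..x}. smooth_part y n \<in> B \<inter> {1..z}}
      \<le> (\<Sum>b\<in>B \<inter> {1..z}. card {n\<in>{1..x}. smooth_part y n = b})"
    by (simp only:) (rule card_UN_le, simp)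
  also have "\<dots> \<le> (\<Sum>b\<in>B \<inter> {1..z}. (x div b div Q + 1) * \<phi>)"
    unfolding Q_def \<phi>_def by (intro sum_mono card_smooth_part_eq_le) auto
  finally have "real (card {n\<in>{1..x}. smooth_part y n \<in> B \<inter> {1..z}})
      \<le> real (\<Sum>b\<in>B \<inter> {1..z}. (x div b div Q + 1) * \<phi>)" by (rule of_nat_mono)
  also have "\<dots> \<le> (\<Sum>b\<in>B \<inter> {1..z}. (real x * (real \<phi> / real Q)) * (1 / real b) + real \<phi>)"
    unfolding of_nat_sum
  proof (rule sum_mono)
    fix b assume b: "b \<in> B \<inter> {1..z}"
    have "real (x div b div Q) \<le> real (x div b) / real Q" by (rule of_nat_div_le_of_nat)
    also have "\<dots> \<le> real x / real b / real Q"
      by (intro divide_right_mono of_nat_div_le_of_nat) auto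
    finally have "real (x div b div Q + 1) * real \<phi> \<le> (real x / real b / real Q + 1) * real \<phi>"
      by (intro mult_right_mono) auto
    then show "real ((x div b div Q + 1) * \<phi>)
        \<le> (real x * (real \<phi> / real Q)) * (1 / real b) + real \<phi>"
      by (simp add: algebra_simps)
  qed
  also have "\<dots> = real x * S * (real \<phi> / real Q) + real (card (B \<inter> {1..z})) * real \<phi>"
    unfolding sum.distrib sum_distrib_left[symmetric] S_def by simp
  also have "\<dots> \<le> real x * S * (1 / harm y) + real z * real Q"
  proof (intro add_mono mult_left_mono mult_mono)
    show "real \<phi> / real Q \<le> 1 / harm y"
    proof -
      have "real \<phi> * harm y \<le> real Q"
        using card_coprime_fact_le[of y] by (simp only: \<phi>_def Q_def of_nat_fact)
      then show ?thesis using H Q by (simp add: pos_divide_le_eq pos_le_divide_eq)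
    qed
    have "card (B \<inter> {1..z}) \<le> card {1..z}" by (intro card_mono) auto
    then show "real (card (B \<inter> {1..z})) \<le> real z" by simp
  qed (use S \<phi> in auto)
  finally show ?thesis by (simp add: S_def Q_def)
qed

text \<open>The order of choices matters: \<open>K\<close> depends on \<epsilon>, \<open>C\<close>
  on \<open>K\<close>, \<open>y\<close> on \<open>C\<close>, and the threshold \<open>X\<close> for
  \<open>x\<close> on \<open>y\<close>.\<close>

lemma smooth_part_in_null_set:
  assumes "has_natural_density B 0" and "\<epsilon> > 0"
  obtains y where "\<forall>\<^sub>F x in sequentially.
    real (card {n\<in>{1..x}. smooth_part y n \<in> B}) \<le> \<epsilon> * real x"
proof -
  \<comment> \<open>Makes the Markov bound \<open>4 / K\<close> at most \<epsilon>/2.\<close>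
  obtain K :: nat where K: "real K > 8 / \<epsilon>" using reals_Archimedean2 by blast
  have "K > 0" using K assms(2) by (cases K) (auto simp: not_less[symmetric])
  \<comment> \<open>The factor \<open>K + 1\<close> cancels against
    \<open>harm z \<le> (K + 1) * H\<close> below, leaving \<epsilon>/8 of \<open>H\<close>.\<close>
  obtain C where C: "\<And>z. (\<Sum>b\<in>B \<inter> {1..z}. 1 / real b) \<le> \<epsilon> / (8 * (real K + 1)) * harm z + C"
    using sum_inverse_null_set_le[OF assms(1), of "\<epsilon> / (8 * (real K + 1))"] assms(2) by auto
  \<comment> \<open>The bound 1 absorbs the constant in \<open>harm z \<le> ln z + 1\<close>, the
    other one absorbs \<open>C\<close>.\<close>
  have "\<forall>\<^sub>F y in sequentially. ln (real y) \<ge> max 1 (8 * C / \<epsilon>)"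
    using filterlim_compose[OF ln_at_top filterlim_real_sequentially]
    unfolding filterlim_at_top by blast
  with eventually_ge_at_top[of 2]
  have "\<forall>\<^sub>F y in sequentially. y \<ge> 2 \<and> ln (real y) \<ge> max 1 (8 * C / \<epsilon>)"
    by eventually_elim simp
  then obtain y where y: "y \<ge> 2" "ln (real y) \<ge> max 1 (8 * C / \<epsilon>)"
    using eventually_happens'[OF sequentially_bot] by blast
  define z where "z = y ^ K"
  define S where "S = (\<Sum>b\<in>B \<inter> {1..z}. 1 / real b)"
  define H where "H = (harm y :: real)"
  have H: "ln (real y) \<le> H"
    using y(1) unfolding H_def
    by (intro order_trans[OF _ ln_le_harm]) simp
  then have "H > 0" using y(2) by simp
  have "z \<ge> 1" using y(1) by (simp add: z_def)
  \<comment> \<open>The sequence \<open>harm n - ln n\<close> decreases from its value 1 at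
    \<open>n = 1\<close>.\<close>
  then have "harm z \<le> ln (real z) + 1"
    using euler_mascheroni_sequence_decreasing[of 1 z] by (simp add: harm_def)
  also have "\<dots> = real K * ln (real y) + 1" using y(1) by (simp add: z_def ln_realpow)
  also have "\<dots> \<le> real K * H + H" using H y(2) by (intro add_mono mult_left_mono) auto
  finally have hz: "harm z \<le> (real K + 1) * H" by (simp add: algebra_simps)
  have "S \<le> \<epsilon> / (8 * (real K + 1)) * harm z + C" unfolding S_def by (rule C)
  also have "\<dots> \<le> \<epsilon> / (8 * (real K + 1)) * ((real K + 1) * H) + \<epsilon> / 8 * H"
  proof (intro add_mono mult_left_mono hz)
    have "8 * C / \<epsilon> \<le> H" using H y(2) by simp
    then show "C \<le> \<epsilon> / 8 * H" using assms(2) by (simp add: field_simps)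
  qed (use assms(2) in auto)
  also have "\<dots> = \<epsilon> / 4 * H"
  proof -
    have "real K + 1 \<noteq> 0" by linarith
    then show ?thesis by (simp add: field_simps)
  qed
  finally have SH: "S / H \<le> \<epsilon> / 4" using \<open>H > 0\<close> by (simp add: field_simps)
  \<comment> \<open>From \<open>X\<close> on, the error \<open>z * y!\<close> is at most
    \<epsilon>/4 of \<open>x\<close>.\<close>
  obtain X :: nat where X: "real X > 4 * (real z * fact y) / \<epsilon>" using reals_Archimedean2 by blast
  have "real (card {n\<in>{1..x}. smooth_part y n \<in> B}) \<le> \<epsilon> * real x" if "x \<ge> X" for x
  proof -
    have "{n\<in>{1..x}. smooth_part y n \<in> B} \<subseteq>
        {n\<in>{1..x}. smooth_part y n > z} \<union> {n\<in>{1..x}. smooth_part y n \<in> B \<inter> {1..z}}"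
      using smooth_part_pos by (auto simp: Suc_le_eq)
    then have "card {n\<in>{1..x}. smooth_part y n \<in> B} \<le>
        card ({n\<in>{1..x}. smooth_part y n > z} \<union> {n\<in>{1..x}. smooth_part y n \<in> B \<inter> {1..z}})"
      by (intro card_mono) auto
    also have "\<dots> \<le> card {n\<in>{1..x}. smooth_part y n > z}
        + card {n\<in>{1..x}. smooth_part y n \<in> B \<inter> {1..z}}" by (rule card_Un_le)
    finally have "real (card {n\<in>{1..x}. smooth_part y n \<in> B})
        \<le> real (card {n\<in>{1..x}. smooth_part y n > z})
        + real (card {n\<in>{1..x}. smooth_part y n \<in> B \<inter> {1..z}})"
      by (simp only: of_nat_add[symmetric] of_nat_le_iff)
    also have "\<dots> \<le> 4 * real x / real K + (real x * S / H + real z * fact y)"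
      unfolding z_def S_def H_def using y(1) \<open>K > 0\<close>
      by (intro add_mono card_large_smooth_part card_smooth_part_in_le) auto
    also have "\<dots> \<le> \<epsilon> / 2 * real x + (\<epsilon> / 4 * real x + \<epsilon> / 4 * real x)"
    proof (intro add_mono)
      have "4 / real K \<le> \<epsilon> / 2" using K \<open>K > 0\<close> assms(2) by (simp add: field_simps)
      from mult_right_mono[OF this, of "real x"]
      show "4 * real x / real K \<le> \<epsilon> / 2 * real x" by simp
      from mult_right_mono[OF SH, of "real x"]
      show "real x * S / H \<le> \<epsilon> / 4 * real x" by (simp add: mult_ac)
      have "4 * (real z * fact y) / \<epsilon> \<le> real x" using X that by linarith
      then show "real z * fact y \<le> \<epsilon> / 4 * real x" using assms(2) by (simp add: field_simps)
    qed
    finally show ?thesis by simp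
  qed
  then show ?thesis using that[of y] unfolding eventually_sequentially by blast
qed

section \<open>Prime powers and the number of prime divisors\<close>

text \<open>The exponent 0 is allowed: with 1 included, the set is divisor closed.\<close>

definition prime_powers :: "nat set" where
  "prime_powers = {p ^ k | p k. prime p}"

lemma divisor_closed_times:
  assumes "divisor_closed A" "divisor_closed B"
  shows "divisor_closed (A * B)"
  unfolding divisor_closed_def
proof (intro ballI allI impI)
  fix n d assume "n \<in> A * B" "d dvd n"
  then obtain a b where ab: "a \<in> A" "b \<in> B" "d dvd a * b" by (auto elim: set_times_elim)
  then obtain a' b' where "d = a' * b'" "a' dvd a" "b' dvd b"
    using division_decomp by blast
  with ab assms show "d \<in> A * B" by (auto simp: divisor_closed_def intro!: set_times_intro)
qed

lemma divisor_closed_prime_powers: "divisor_closed prime_powers"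
  unfolding divisor_closed_def prime_powers_def
  by (auto simp: divides_primepow_nat) blast

lemma omega_at_most_0: "omega_at_most 0 = {1}"
proof -
  have "n = 1" if "n > 0" "omega n = 0" for n
  proof (rule ccontr)
    assume "n \<noteq> 1"
    then obtain p where "prime p" "p dvd n" using prime_factor_nat by blast
    with that show False by (auto simp: omega_def prime_factors_dvd)
  qed
  then show ?thesis by (auto simp: omega_at_most_def omega_def)
qed

text \<open>Splitting off the full power of one prime divisor leaves a cofactor with fewer prime
  divisors.\<close>

lemma omega_at_most_Suc_subset: "omega_at_most (Suc m) \<subseteq> prime_powers * omega_at_most m"
proof
  fix n assume n: "n \<in> omega_at_most (Suc m)"
  show "n \<in> prime_powers * omega_at_most m"
  proof (cases "n = 1")
    case True
    \<comment> \<open>The number 1 has no prime to split off, so any prime to the power 0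
      serves.\<close>
    have "2 ^ 0 \<in> prime_powers" unfolding prime_powers_def using two_is_prime_nat by blast
    moreover have "1 \<in> omega_at_most m" by (simp add: omega_at_most_def omega_def)
    ultimately have "2 ^ 0 * 1 \<in> prime_powers * omega_at_most m" by (rule set_times_intro)
    with True show ?thesis by simp
  next
    case False
    then obtain p where p: "prime p" "p dvd n" using prime_factor_nat by blast
    have "n > 0" using n by (simp add: omega_at_most_def)
    obtain r where r: "n = p ^ multiplicity p n * r" "\<not> p dvd r"
      using multiplicity_decompose'[of n p] \<open>n > 0\<close> p(1) prime_gt_1_nat[OF p(1)] by auto
    have "r > 0" using r \<open>n > 0\<close> by (cases r) auto
    have "r dvd n" using r(1) by (metis dvd_triv_right)
    then have "prime_factors r \<subset> prime_factors n"
      using p r(2) \<open>n > 0\<close> by (auto simp: prime_factors_dvd)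
    then have "omega r < omega n" unfolding omega_def by (intro psubset_card_mono) auto
    then have "r \<in> omega_at_most m" using n \<open>r > 0\<close> by (simp add: omega_at_most_def)
    moreover have "p ^ multiplicity p n \<in> prime_powers" using p by (auto simp: prime_powers_def)
    ultimately show ?thesis by (subst r(1)) (rule set_times_intro)
  qed
qed

section \<open>Multiplying a null set by the prime powers\<close>

lemma card_multiples_le: "real (card {n\<in>{1..x}. d dvd n}) \<le> real x / real d"
proof -
  have "card {n\<in>{1..x}. d dvd n} \<le> card {1..x div d}"
  proof (rule card_inj_on_le[where f = "\<lambda>n. n div d"])
    show "inj_on (\<lambda>n. n div d) {n\<in>{1..x}. d dvd n}"
      by (rule inj_onI) (auto elim!: dvdE)
    show "(\<lambda>n. n div d) ` {n\<in>{1..x}. d dvd n} \<subseteq> {1..x div d}"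
      by (auto simp: div_le_mono Suc_le_eq div_greater_zero_iff dvd_imp_le dvd_pos_nat)
  qed auto
  then have "real (card {n\<in>{1..x}. d dvd n}) \<le> real (x div d)" by simp
  also have "\<dots> \<le> real x / real d" by (rule of_nat_div_le_of_nat)
  finally show ?thesis .
qed

text \<open>Since \<open>b \<le> b * d\<close>, preimages stay below \<open>x\<close>. The bound is
  uniform in \<open>d\<close>, so one threshold for \<open>x\<close> serves all dilates.\<close>

lemma card_dilation_le:
  fixes B :: "nat set"
  assumes "d > 0" "B \<subseteq> {0<..}"
  shows "card ((\<lambda>b. b * d) ` B \<inter> {1..x}) \<le> card (B \<inter> {1..x})"
proof -
  have "(\<lambda>b. b * d) ` B \<inter> {1..x} \<subseteq> (\<lambda>b. b * d) ` (B \<inter> {1..x})"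
  proof
    fix n assume "n \<in> (\<lambda>b. b * d) ` B \<inter> {1..x}"
    then obtain b where b: "b \<in> B" "n = b * d" "b * d \<le> x" by auto
    have "b \<le> b * d" using assms by simp
    then have "b \<le> x" using b by linarith
    then have "b \<in> B \<inter> {1..x}" using b assms(2) by (auto simp: Suc_le_eq)
    with b(2) show "n \<in> (\<lambda>b. b * d) ` (B \<inter> {1..x})" by blast
  qed
  then have "card ((\<lambda>b. b * d) ` B \<inter> {1..x}) \<le> card ((\<lambda>b. b * d) ` (B \<inter> {1..x}))"
    by (intro card_mono) auto
  also have "\<dots> \<le> card (B \<inter> {1..x})" by (rule card_image_le) simp
  finally show ?thesis .
qed

text \<open>For \<open>p \<le> y\<close> the exponents are cut at \<open>J\<close>: smaller ones
  give finitely many dilates of \<open>B\<close>, the others only multiples of \<open>p ^ J\<close>,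
  which are sparse for large \<open>J\<close>.\<close>

lemma times_prime_powers_subset:
  assumes "B \<subseteq> {0<..}" "divisor_closed B"
  shows "B * prime_powers \<subseteq> {n. smooth_part y n \<in> B}
      \<union> (\<Union>(p, j)\<in>{p. prime p \<and> p \<le> y} \<times> {..<J}. (\<lambda>b. b * p ^ j) ` B)
      \<union> (\<Union>p\<in>{p. prime p \<and> p \<le> y}. {n. p ^ J dvd n})"
proof
  fix n assume "n \<in> B * prime_powers"
  then obtain b p j where n: "n = b * p ^ j" "b \<in> B" "prime p"
    by (auto simp: prime_powers_def elim!: set_times_elim)
  have pos: "b > 0" "p > 0" using n assms by (auto simp: prime_gt_0_nat)
  consider "p > y" | "p \<le> y" "j < J" | "p \<le> y" "J \<le> j" by linarith
  then show "n \<in> {n. smooth_part y n \<in> B}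
      \<union> (\<Union>(p, j)\<in>{p. prime p \<and> p \<le> y} \<times> {..<J}. (\<lambda>b. b * p ^ j) ` B)
      \<union> (\<Union>p\<in>{p. prime p \<and> p \<le> y}. {n. p ^ J dvd n})"
  proof cases
    case 1
    have "smooth_part y (p ^ j) = 1"
    proof (rule smooth_part_eq_1)
      fix q assume q: "prime q" "q \<le> y"
      show "\<not> q dvd p ^ j"
        using q 1 n(3) by (metis leD prime_dvd_power primes_dvd_imp_eq)
    qed
    then have "smooth_part y n = smooth_part y b" using pos by (simp add: n(1) smooth_part_mult)
    moreover have "smooth_part y b \<in> B"
      using assms(2) n(2) smooth_part_dvd[OF pos(1)] by (auto simp: divisor_closed_def)
    ultimately show ?thesis by simp
  next
    case 2
    with n show ?thesis by blast
  next
    case 3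
    then have "p ^ J dvd n" by (simp add: n(1) le_imp_power_dvd)
    with 3 n(3) show ?thesis by blast
  qed
qed

text \<open>Each of the three sets in the covering gets a share \<epsilon>/4. First \<open>y\<close>
  is fixed, then \<open>J\<close>, then the density bound \<eta> for \<open>B\<close>.\<close>

lemma density_0_times_prime_powers:
  assumes "B \<subseteq> {0<..}" "divisor_closed B" "has_natural_density B 0"
  shows "has_natural_density (B * prime_powers) 0"
  unfolding has_natural_density_0_iff
proof (intro allI impI)
  fix \<epsilon> :: real assume \<epsilon>: "\<epsilon> > 0"
  obtain y where y: "\<forall>\<^sub>F x in sequentially.
      real (card {n\<in>{1..x}. smooth_part y n \<in> B}) \<le> \<epsilon> / 4 * real x"
    using smooth_part_in_null_set[OF assms(3), of "\<epsilon> / 4"] \<epsilon> by auto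
  \<comment> \<open>At most \<open>y\<close> primes occur, each with multiples of
    \<open>p ^ J\<close> of density at most 1/2^J.\<close>
  obtain J :: nat where "4 * real y / \<epsilon> < 2 ^ J" using real_arch_pow[of 2] by auto
  then have J: "real y / 2 ^ J \<le> \<epsilon> / 4" using \<epsilon> by (simp add: field_simps)
  define I where "I = {p :: nat. prime p \<and> p \<le> y}"
  have I: "finite I" unfolding I_def by (rule finite_primes_le)
  have "I \<subseteq> {1..y}" unfolding I_def by (auto simp: Suc_le_eq prime_gt_0_nat)
  then have "card I \<le> card {1..y}" by (intro card_mono) auto
  then have cI: "real (card I) \<le> real y" by simp
  \<comment> \<open>There are at most \<open>y * J\<close> dilates; the summand 1 keeps the
    denominator positive.\<close>
  define \<eta> where "\<eta> = \<epsilon> / (4 * (real y * real J + 1))"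
  have yJ: "real y * real J + 1 > 0" by (simp add: add_nonneg_pos)
  have "\<eta> > 0" using \<epsilon> yJ by (simp add: \<eta>_def)
  have \<eta>: "real y * real J * \<eta> \<le> \<epsilon> / 4"
    using \<epsilon> yJ by (simp add: \<eta>_def field_simps)
  have "\<forall>\<^sub>F x in sequentially. real (card (B \<inter> {1..x})) \<le> \<eta> * real x"
    using assms(3) \<open>\<eta> > 0\<close> unfolding has_natural_density_0_iff by blast
  with y show "\<forall>\<^sub>F x in sequentially. real (card (B * prime_powers \<inter> {1..x})) \<le> \<epsilon> * real x"
  proof eventually_elim
    case (elim x)
    let ?A1 = "{n\<in>{1..x}. smooth_part y n \<in> B}"
    let ?F2 = "\<lambda>(p, j). (\<lambda>b. b * p ^ j) ` B \<inter> {1..x}"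
    let ?F3 = "\<lambda>p. {n\<in>{1..x}. p ^ J dvd n}"
    have fin2: "finite (\<Union>i\<in>I \<times> {..<J}. ?F2 i)" and fin3: "finite (\<Union>p\<in>I. ?F3 p)"
      using I by auto
    have "B * prime_powers \<inter> {1..x} \<subseteq> ?A1 \<union> (\<Union>i\<in>I \<times> {..<J}. ?F2 i) \<union> (\<Union>p\<in>I. ?F3 p)"
      using Int_mono[OF times_prime_powers_subset[OF assms(1,2), of y J, folded I_def] order_refl[of "{1..x}"]]
      by (rule order_trans) auto
    then have "card (B * prime_powers \<inter> {1..x})
        \<le> card (?A1 \<union> (\<Union>i\<in>I \<times> {..<J}. ?F2 i) \<union> (\<Union>p\<in>I. ?F3 p))"
      using fin2 fin3 by (intro card_mono) auto
    also have "\<dots> \<le> card ?A1 + card (\<Union>i\<in>I \<times> {..<J}. ?F2 i) + card (\<Union>p\<in>I. ?F3 p)"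
      using card_Un_le[of "?A1 \<union> (\<Union>i\<in>I \<times> {..<J}. ?F2 i)" "\<Union>p\<in>I. ?F3 p"]
        card_Un_le[of ?A1 "\<Union>i\<in>I \<times> {..<J}. ?F2 i"] by linarith
    also have "\<dots> \<le> card ?A1 + (\<Sum>i\<in>I \<times> {..<J}. card (?F2 i)) + (\<Sum>p\<in>I. card (?F3 p))"
      using I by (intro add_mono card_UN_le order_refl finite_cartesian_product) auto
    finally have "real (card (B * prime_powers \<inter> {1..x}))
        \<le> real (card ?A1) + (\<Sum>i\<in>I \<times> {..<J}. real (card (?F2 i))) + (\<Sum>p\<in>I. real (card (?F3 p)))"
      by (simp only: of_nat_add[symmetric] of_nat_sum[symmetric] of_nat_le_iff)
    also have "\<dots> \<le> \<epsilon> / 4 * real x + (\<Sum>i\<in>I \<times> {..<J}. \<eta> * real x) + (\<Sum>p\<in>I. real x / 2 ^ J)"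
    proof (intro add_mono sum_mono elim(1))
      fix i assume "i \<in> I \<times> {..<J}"
      then obtain p j where i: "i = (p, j)" "p > 0" by (auto simp: I_def prime_gt_0_nat)
      have "card (?F2 i) \<le> card (B \<inter> {1..x})"
        using card_dilation_le[OF _ assms(1), of "p ^ j" x] i by simp
      then show "real (card (?F2 i)) \<le> \<eta> * real x" using elim(2) by linarith
    next
      fix p assume "p \<in> I"
      then have p: "p \<ge> 2" by (auto simp: I_def prime_ge_2_nat)
      have "real (card (?F3 p)) \<le> real x / real (p ^ J)" by (rule card_multiples_le)
      also have "\<dots> \<le> real x / 2 ^ J"
        using p by (intro divide_left_mono) (auto intro!: power_mono)
      finally show "real (card (?F3 p)) \<le> real x / 2 ^ J" .
    qed
    also have "\<dots> = (\<epsilon> / 4 + real (card I) * real J * \<eta> + real (card I) / 2 ^ J) * real x"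
      by (simp add: algebra_simps card_cartesian_product)
    also have "\<dots> \<le> (\<epsilon> / 4 + real y * real J * \<eta> + real y / 2 ^ J) * real x"
      using cI \<open>\<eta> > 0\<close> by (intro mult_right_mono add_mono divide_right_mono) auto
    also have "\<dots> \<le> \<epsilon> * real x"
    proof (rule mult_right_mono)
      show "\<epsilon> / 4 + real y * real J * \<eta> + real y / 2 ^ J \<le> \<epsilon>" using \<eta> J \<epsilon> by linarith
    qed simp
    finally show ?case .
  qed
qed

section \<open>Induction on the number of prime divisors\<close>

lemma has_natural_density_0_subset:
  assumes "has_natural_density A 0" "A' \<subseteq> A"
  shows "has_natural_density A' 0"
  unfolding has_natural_density_0_iff
proof (intro allI impI)
  fix \<epsilon> :: real assume "\<epsilon> > 0"
  with assms(1) have "\<forall>\<^sub>F x in sequentially. real (card (A \<inter> {1..x})) \<le> \<epsilon> * real x"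
    unfolding has_natural_density_0_iff by blast
  then show "\<forall>\<^sub>F x in sequentially. real (card (A' \<inter> {1..x})) \<le> \<epsilon> * real x"
  proof eventually_elim
    case (elim x)
    have "card (A' \<inter> {1..x}) \<le> card (A \<inter> {1..x})" using assms(2) by (intro card_mono) auto
    with elim show ?case by linarith
  qed
qed

theorem theoremA1:
  fixes m :: nat and B :: "nat set"
  assumes "B \<subseteq> {0<..}"
    and "divisor_closed B"
    and "has_natural_density B 0"
  shows "has_natural_density (B * omega_at_most m) 0"
  using assms
\<comment> \<open>\<open>B\<close> must vary: the induction hypothesis is applied to
  \<open>B * prime_powers\<close>, again a divisor closed null set.\<close>
proof (induction m arbitrary: B)
  case 0
  have "B * {1} = B" by (auto simp: set_times_def)
  then show ?case using 0 by (simp add: omega_at_most_0)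
next
  case (Suc m)
  have "B * prime_powers \<subseteq> {0<..}"
    using Suc.prems(1) by (auto simp: prime_powers_def prime_gt_0_nat elim!: set_times_elim)
  then have "has_natural_density ((B * prime_powers) * omega_at_most m) 0"
    using Suc.prems
    by (intro Suc.IH divisor_closed_times divisor_closed_prime_powers density_0_times_prime_powers)
  moreover have "B * omega_at_most (Suc m) \<subseteq> (B * prime_powers) * omega_at_most m"
    unfolding mult.assoc by (intro set_times_mono2 omega_at_most_Suc_subset order_refl)
  ultimately show ?case by (rule has_natural_density_0_subset)
qed

end
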